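(* Let $f:\mathbb{F}_{2^n}\to\mathbb{Z}_{2^k}$. The following are equivalent: (i) $f$ is nega-$\mathbb{Z}_{2^k}$-bent; (ii) $f(y+z)-f(y)+2^{k-1}\mathrm{Tr}^n_1(zy)$ (as a function of $y$) is balanced for every nonzero $z\in\mathbb{F}_{2^n}$; (iii) the graph $G_f=\{(x,f(x)):x\in\mathbb{F}_{2^n}\}$ is a $(2^n,2^k,2^n,2^{n-k})$-relative difference set in the group $G=(\mathbb{F}_{2^n}\times\mathbb{Z}_{2^k},+_\star)$ relative to $\{0\}\times\mathbb{Z}_{2^k}$, where $(x_1,y_1)+_\star(x_2,y_2)=(x_1+x_2,\,y_1+y_2+2^{k-1}\mathrm{Tr}^n_1(x_1x_2))$.
   Context: $\mathrm{Tr}^n_1$ is the absolute trace $\mathbb{F}_{2^n}\to\mathbb{F}_2$; trace values are regarded as integers $0,1$ in exponents and in $\mathbb{Z}_{2^k}$. Let $\zeta_{2^k}=e^{2\pi\sqrt{-1}/2^k}$, $i=\sqrt{-1}$. For $x\in\mathbb{F}_{2^n}$ let $\sigma(1,x)=\sum_{0\le i<j\le n-1}x^{2^i}x^{2^j}\in\mathbb{F}_2$, and for $c\in\mathbb{Z}_{2^k}$ let $\sigma(c,x)=\sigma(1,x)$ if $c$ is odd and $0$ if $c$ is even. A function $f:\mathbb{F}_{2^n}\to\mathbb{Z}_{2^k}$ is nega-$\mathbb{Z}_{2^k}$-bent if $$\mathcal{K}_f(c,u)=\sum_{x\in\mathbb{F}_{2^n}}(-1)^{\mathrm{Tr}^n_1(ux)+\sigma(c,x)}\zeta_{2^k}^{cf(x)}i^{\mathrm{Tr}^n_1(c_0x)}$$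 has absolute value $2^{n/2}$ for all $u\in\mathbb{F}_{2^n}$ and all nonzero $c\in\mathbb{Z}_{2^k}$, where $c_0\in\{0,1\}$, $c_0\equiv c\pmod 2$. A balanced function takes every value of its codomain equally often. For a group $G$ of order $\mu\nu$ with subgroup $N$ of order $\nu$, a subset $R$ of size $\kappa$ is a $(\mu,\nu,\kappa,\lambda)$-relative difference set relative to $N$ if every element of $G\setminus N$ can be written as $r_1-r_2$ (difference in $G$) with $r_1,r_2\in R$ in exactly $\lambda$ ways, and no non-identity element of $N$ can be so written. *)

theory Defs
  imports
    Complex_Main
    "HOL-Library.Word"
    "HOL-Algebra.Coset"
    "HOL-Number_Theory.Residues"
begin

text \<open>
  The field with \<open>2 ^ n\<close> elements is a type \<open>'a :: finite_field\<close> with \<open>CARD('a) = 2 ^ n\<close>;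
  its prime field is the subset \<open>{0, 1}\<close>.  The ring of integers modulo \<open>2 ^ k\<close> is the type
  \<open>'k word\<close> with \<open>LENGTH('k) = k\<close>; the class \<open>len\<close> enforces \<open>k \<ge> 1\<close>.
\<close>

definition abs_trace :: "nat \<Rightarrow> 'a::finite_field \<Rightarrow> 'a" where
  "abs_trace n x = (\<Sum>i<n. x ^ (2 ^ i))"

definition sigma_one :: "nat \<Rightarrow> 'a::finite_field \<Rightarrow> 'a" where
  "sigma_one n x = (\<Sum>j<n. \<Sum>i<j. x ^ (2 ^ i) * x ^ (2 ^ j))"

definition sigma :: "nat \<Rightarrow> 'k::len word \<Rightarrow> 'a::finite_field \<Rightarrow> 'a" where
  "sigma n c x = (if odd c then sigma_one n x else 0)"

text \<open>
  An element of the prime field read as an integer.  It is only ever applied to values of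
  \<open>abs_trace\<close> and \<open>sigma\<close>, which lie in \<open>{0, 1}\<close> by the lemmas below.
\<close>

definition bit_val :: "'a::finite_field \<Rightarrow> nat" where
  "bit_val t = (if t = 0 then 0 else 1)"

definition zeta :: "nat \<Rightarrow> complex" where
  "zeta k = exp (2 * of_real pi * \<i> / 2 ^ k)"

definition nega_transform ::
    "nat \<Rightarrow> ('a::finite_field \<Rightarrow> 'k::len word) \<Rightarrow> 'k word \<Rightarrow> 'a \<Rightarrow> complex" where
  "nega_transform n f c u =
     (\<Sum>x\<in>UNIV. (-1) ^ (bit_val (abs_trace n (u * x)) + bit_val (sigma n c x))
        * zeta LENGTH('k) ^ unat (c * f x)
        * \<i> ^ bit_val (abs_trace n (of_nat (unat c mod 2) * x)))"

definition nega_bent :: "nat \<Rightarrow> ('a::finite_field \<Rightarrow> 'k::len word) \<Rightarrow> bool" where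
  "nega_bent n f \<longleftrightarrow>
     (\<forall>u c. c \<noteq> 0 \<longrightarrow> cmod (nega_transform n f c u) = 2 powr (real n / 2))"

definition balanced :: "('a::finite \<Rightarrow> 'b::finite) \<Rightarrow> bool" where
  "balanced g \<longleftrightarrow> (\<forall>v w. card {y. g y = v} = card {y. g y = w})"

text \<open>
  The multiplicity \<open>l\<close> is a real number because it is used at \<open>2 powi (n - k)\<close>, which is not a
  natural number for \<open>n < k\<close>.
\<close>

definition relative_difference_set ::
    "('g, 'm) monoid_scheme \<Rightarrow> 'g set \<Rightarrow> nat \<Rightarrow> nat \<Rightarrow> nat \<Rightarrow> real \<Rightarrow> 'g set \<Rightarrow> bool" where
  "relative_difference_set G N \<mu> \<nu> \<kappa> l R \<longleftrightarrow>
     group G \<and> order G = \<mu> * \<nu> \<and> subgroup N G \<and> card N = \<nu> \<and>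
     R \<subseteq> carrier G \<and> card R = \<kappa> \<and>
     (\<forall>g \<in> carrier G - N.
        real (card {(r1, r2). r1 \<in> R \<and> r2 \<in> R \<and> r1 \<otimes>\<^bsub>G\<^esub> inv\<^bsub>G\<^esub> r2 = g}) = l) \<and>
     (\<forall>g \<in> N - {\<one>\<^bsub>G\<^esub>}. \<not> (\<exists>r1\<in>R. \<exists>r2\<in>R. r1 \<otimes>\<^bsub>G\<^esub> inv\<^bsub>G\<^esub> r2 = g))"

definition star_group :: "nat \<Rightarrow> ('a::finite_field \<times> 'k::len word) monoid" where
  "star_group n =
     \<lparr> carrier = UNIV,
       monoid.mult = (\<lambda>(x1, y1) (x2, y2).
         (x1 + x2, y1 + y2 + 2 ^ (LENGTH('k) - 1) * of_nat (bit_val (abs_trace n (x1 * x2))))),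
       one = (0, 0) \<rparr>"

lemma char_two:
  assumes "CARD('a::finite_field) = 2 ^ n"
  shows "CHAR('a) = 2"
proof -
  have "CHAR('a) dvd 2 ^ n"
    using CHAR_dvd_CARD[where ?'a = 'a] assms by simp
  then have "CHAR('a) dvd 2"
    using prime_dvd_power[OF CHAR_prime[where ?'a = 'a]] by blast
  then show ?thesis
    using CHAR_prime[where ?'a = 'a] primes_dvd_imp_eq two_is_prime_nat by blast
qed

lemma frobenius_sum:
  assumes "CARD('a::finite_field) = 2 ^ n"
  shows "(\<Sum>i\<in>A. g i :: 'a) ^ 2 = (\<Sum>i\<in>A. g i ^ 2)"
  by (rule freshmans_dream_sum) (simp_all only: char_two[OF assms] two_is_prime_nat)

lemma idem_imp_prime_field:
  assumes "(t::'a::finite_field) ^ 2 = t"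
  shows "t \<in> {0, 1}"
  using assms by (auto simp: power2_eq_square)

lemma square_power_two_power: "((x::'a::monoid_mult) ^ (2 ^ i)) ^ 2 = x ^ (2 ^ Suc i)"
  by (metis power_Suc2 power_mult)

lemma abs_trace_in_prime_field:
  assumes "CARD('a::finite_field) = 2 ^ n"
  shows "abs_trace n (x::'a) \<in> {0, 1}"
proof (rule idem_imp_prime_field)
  have n: "x ^ (2 ^ n) = x"
    using finite_field_power_card_eq_same[of x] assms by simp
  have "abs_trace n x ^ 2 = (\<Sum>i<n. x ^ (2 ^ Suc i))"
    by (simp only: abs_trace_def frobenius_sum[OF assms] square_power_two_power)
  moreover have "(\<Sum>i<n. x ^ (2 ^ Suc i)) + x = (\<Sum>i<n. x ^ (2 ^ i)) + x ^ (2 ^ n)"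
    using sum.lessThan_Suc_shift[of "\<lambda>i. x ^ (2 ^ i)" n] by (simp add: add.commute)
  ultimately show "abs_trace n x ^ 2 = abs_trace n x"
    by (simp add: n abs_trace_def)
qed

lemma sigma_one_in_prime_field:
  assumes "CARD('a::finite_field) = 2 ^ n"
  shows "sigma_one n (x::'a) \<in> {0, 1}"
proof (cases n)
  case 0
  then show ?thesis by (simp add: sigma_one_def)
next
  case (Suc m)
  define a where "a i = x ^ (2 ^ i)" for i :: nat
  have sq: "a i ^ 2 = a (Suc i)" for i
    by (simp only: a_def square_power_two_power)
  have wrap: "a (Suc m) = a 0"
    using finite_field_power_card_eq_same[of x] assms Suc by (simp add: a_def)
  have s: "sigma_one n x = (\<Sum>j<Suc m. \<Sum>i<j. a i * a j)"
    by (simp add: sigma_one_def a_def Suc)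
  have "sigma_one n x ^ 2 = (\<Sum>j<Suc m. \<Sum>i<j. a (Suc i) * a (Suc j))"
    by (simp only: s frobenius_sum[OF assms] power_mult_distrib sq)
  also have "\<dots> = (\<Sum>j<m. \<Sum>i<j. a (Suc i) * a (Suc j)) + (\<Sum>j<m. a 0 * a (Suc j))"
    by (simp add: wrap mult.commute)
  also have "\<dots> = (\<Sum>j<m. \<Sum>i<Suc j. a i * a (Suc j))"
    by (simp only: sum.lessThan_Suc_shift sum.distrib add.commute)
  also have "\<dots> = sigma_one n x"
    unfolding s by (subst (2) sum.lessThan_Suc_shift) simp
  finally show ?thesis by (rule idem_imp_prime_field)
qed

lemma sigma_in_prime_field:
  assumes "CARD('a::finite_field) = 2 ^ n"
  shows "sigma n c (x::'a) \<in> {0, 1}"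
  using sigma_one_in_prime_field[OF assms] by (simp add: sigma_def)

end

theory Submission
  imports Defs "HOL-Computational_Algebra.Polynomial"
begin

text \<open>
  Put \<open>s\<^sub>c(x) = (-1)\<^bsup>\<sigma>(c,x)\<^esup> i\<^bsup>Tr(c\<^sub>0 x)\<^esup>\<close> and
  \<open>D\<^sub>z(y) = f(y+z) - f(y) + 2\<^bsup>k-1\<^esup> Tr(zy)\<close>.  The identity
  \<open>s\<^sub>c(x+z) = s\<^sub>c(x) s\<^sub>c(z) \<zeta>\<^bsup>c 2^(k-1) Tr(xz)\<^esup>\<close> turns the squared modulus of the transform into
  the Fourier transform, in \<open>u\<close>, of \<open>z \<mapsto> s\<^sub>c(z) A\<^sub>c(z)\<close> with
  \<open>A\<^sub>c(z) = \<Sum>\<^sub>y \<zeta>\<^bsup>c D\<^sub>z(y)\<^esup>\<close>, a function with value \<open>2\<^sup>n\<close> at \<open>z = 0\<close>.  By Fourier inversion on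
  the field, \<open>f\<close> is nega-bent iff \<open>A\<^sub>c(z) = 0\<close> for all nonzero \<open>c\<close> and \<open>z\<close>; by Fourier inversion on
  the integers modulo \<open>2\<^sup>k\<close> this says that every \<open>D\<^sub>z\<close> with \<open>z \<noteq> 0\<close> is balanced.  Finally
  \<open>(z, w)\<close> is a difference of the graph points over \<open>y + z\<close> and \<open>y\<close> iff \<open>D\<^sub>z(y) = w\<close>.
\<close>

section \<open>Characters of finite commutative rings\<close>

text \<open>Translation by \<open>a\<close> permutes the group and multiplies the sum by
  \<open>\<psi> a\<close>, which differs from 1.\<close>

lemma sum_additive_character_eq_0:
  fixes \<psi> :: "'g::{finite,ab_group_add} \<Rightarrow> complex"
  assumes add: "\<And>x y. \<psi> (x + y) = \<psi> x * \<psi> y" and a: "\<psi> a \<noteq> 1"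
  shows "(\<Sum>x\<in>UNIV. \<psi> x) = 0"
proof -
  have "(\<Sum>x\<in>UNIV. \<psi> x) = (\<Sum>x\<in>UNIV. \<psi> (a + x))"
    by (rule sum.reindex_bij_witness[of _ "\<lambda>x. a + x" "\<lambda>x. x - a"]) auto
  also have "\<dots> = \<psi> a * (\<Sum>x\<in>UNIV. \<psi> x)"
    by (simp add: add sum_distrib_left)
  finally show ?thesis using a by simp
qed

text \<open>Used for two rings: the field with its trace character and the words with
  \<open>word_char\<close>. Nondegeneracy makes every additive character of the form
  \<open>\<lambda>x. \<psi> (u * x)\<close>, so the ring serves as its own dual.\<close>

locale nondegenerate_character =
  fixes \<psi> :: "'r::{finite,comm_ring_1} \<Rightarrow> complex"
  assumes add: "\<psi> (x + y) = \<psi> x * \<psi> y"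
    and norm_1: "cmod (\<psi> x) = 1"
    and nondegenerate: "x \<noteq> 0 \<Longrightarrow> \<exists>u. \<psi> (u * x) \<noteq> 1"
begin

lemma zero [simp]: "\<psi> 0 = 1"
  using add[of 0 0] norm_1[of 0] by auto

lemma mult_cnj [simp]: "\<psi> x * cnj (\<psi> x) = 1"
  using norm_1[of x] by (simp add: complex_norm_square[symmetric])

lemma minus: "\<psi> (- x) = cnj (\<psi> x)"
proof -
  have "\<psi> x * \<psi> (- x) = \<psi> x * cnj (\<psi> x)"
    by (simp flip: add)
  moreover have "\<psi> x \<noteq> 0" using norm_1[of x] by auto
  ultimately show ?thesis by (metis mult_cancel_left)
qed

lemma diff: "\<psi> (x - y) = \<psi> x * cnj (\<psi> y)"
  using add[of x "- y"] by (simp add: minus)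

lemma orthogonality: "(\<Sum>u\<in>UNIV. \<psi> (u * x)) = (if x = 0 then of_nat CARD('r) else 0)"
proof (cases "x = 0")
  case False
  then obtain a where "\<psi> (a * x) \<noteq> 1" using nondegenerate by blast
  then have "(\<Sum>u\<in>UNIV. \<psi> (u * x)) = 0"
    by (intro sum_additive_character_eq_0) (auto simp: add distrib_right)
  then show ?thesis using False by simp
qed simp

section \<open>Fourier inversion on a finite commutative ring\<close>

definition fourier :: "('r \<Rightarrow> complex) \<Rightarrow> 'r \<Rightarrow> complex" where
  "fourier g u = (\<Sum>z\<in>UNIV. \<psi> (u * z) * g z)"

lemma fourier_inversion: "(\<Sum>u\<in>UNIV. \<psi> (- (u * w)) * fourier g u) = of_nat CARD('r) * g w"
proof -
  have "(\<Sum>u\<in>UNIV. \<psi> (- (u * w)) * fourier g u)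
      = (\<Sum>u\<in>UNIV. \<Sum>z\<in>UNIV. \<psi> (u * (z - w)) * g z)"
    unfolding fourier_def sum_distrib_left
    by (intro sum.cong refl) (simp add: right_diff_distrib diff minus)
  also have "\<dots> = (\<Sum>z\<in>UNIV. (\<Sum>u\<in>UNIV. \<psi> (u * (z - w))) * g z)"
    by (subst sum.swap) (simp add: sum_distrib_right)
  also have "\<dots> = (\<Sum>z\<in>UNIV. if z = w then of_nat CARD('r) * g z else 0)"
    by (intro sum.cong refl) (simp add: orthogonality)
  finally show ?thesis by simp
qed

text \<open>Inverting a constant transform leaves a character sum that vanishes at every nonzero
  point, by orthogonality.\<close>

lemma fourier_eq_const_iff: "(\<forall>u. fourier g u = g 0) \<longleftrightarrow> (\<forall>z. z \<noteq> 0 \<longrightarrow> g z = 0)"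
proof (intro iffI allI impI)
  fix w :: 'r
  assume "\<forall>u. fourier g u = g 0" and w: "w \<noteq> 0"
  then have "of_nat CARD('r) * g w = (\<Sum>u\<in>UNIV. \<psi> (u * (- w))) * g 0"
    using fourier_inversion[of w g] by (simp add: sum_distrib_right)
  then show "g w = 0" using w by (simp only: orthogonality) simp
next
  fix u
  assume *: "\<forall>z. z \<noteq> 0 \<longrightarrow> g z = 0"
  have "fourier g u = (\<Sum>z\<in>UNIV. if z = 0 then g z else 0)"
    unfolding fourier_def by (rule sum.cong) (auto simp: *)
  then show "fourier g u = g 0" by simp
qed

text \<open>Dual to \<open>fourier_eq_const_iff\<close>: if the transform is supported at 0, only
  the term \<open>u = 0\<close> survives in the inversion formula, and it does not depend on the
  point.\<close>

lemma fourier_eq_0_iff: "(\<forall>u. u \<noteq> 0 \<longrightarrow> fourier g u = 0) \<longleftrightarrow> (\<forall>v w. g v = g w)"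
proof (intro iffI allI impI)
  fix v w
  assume *: "\<forall>u. u \<noteq> 0 \<longrightarrow> fourier g u = 0"
  have "of_nat CARD('r) * g w = fourier g 0" for w
  proof -
    have "(\<Sum>u\<in>UNIV. \<psi> (- (u * w)) * fourier g u) = (\<Sum>u\<in>UNIV. if u = 0 then fourier g u else 0)"
      by (rule sum.cong) (auto simp: *)
    then show ?thesis by (simp add: fourier_inversion)
  qed
  then have "of_nat CARD('r) * g v = of_nat CARD('r) * g w" by metis
  then show "g v = g w" by simp
next
  fix u :: 'r
  assume *: "\<forall>v w. g v = g w" and u: "u \<noteq> 0"
  have "fourier g u = (\<Sum>z\<in>UNIV. \<psi> (z * u)) * g 0"
    unfolding fourier_def sum_distrib_right by (intro sum.cong refl) (metis * mult.commute)
  then show "fourier g u = 0" using u by (simp add: orthogonality)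
qed

text \<open>Grouping \<open>y\<close> by the value of \<open>h\<close> turns the character sums into
  the Fourier transform of the fibre sizes, and balance says that these sizes are constant.\<close>

lemma balanced_iff_character_sums:
  fixes h :: "'b::finite \<Rightarrow> 'r"
  shows "balanced h \<longleftrightarrow> (\<forall>c. c \<noteq> 0 \<longrightarrow> (\<Sum>y\<in>UNIV. \<psi> (c * h y)) = 0)"
proof -
  have "(\<Sum>y\<in>UNIV. \<psi> (c * h y)) = fourier (\<lambda>v. of_nat (card {y. h y = v})) c" for c
  proof -
    have "(\<Sum>y\<in>UNIV. \<psi> (c * h y)) = (\<Sum>v\<in>UNIV. \<Sum>y | y \<in> UNIV \<and> h y = v. \<psi> (c * h y))"
      by (rule sum.group[symmetric]) auto
    also have "\<dots> = (\<Sum>v\<in>UNIV. \<Sum>y | h y = v. \<psi> (c * v))"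
      by (intro sum.cong) auto
    finally show ?thesis by (simp add: fourier_def mult.commute)
  qed
  then show ?thesis
    by (simp only: fourier_eq_0_iff balanced_def of_nat_eq_iff)
qed

end

section \<open>The canonical character of the integers modulo a power of two\<close>

definition word_char :: "'k::len word \<Rightarrow> complex" where
  "word_char w = zeta LENGTH('k) ^ unat w"

lemma zeta_power_eq: "zeta k ^ m = cis (2 * pi * (real m / 2 ^ k))"
  by (simp add: zeta_def cis_conv_exp flip: exp_of_nat_mult) (simp add: mult_ac)

lemma zeta_power_eq_1_iff: "zeta k ^ m = 1 \<longleftrightarrow> 2 ^ k dvd m"
proof -
  \<comment> \<open>Since \<open>cos t = 1\<close> forces \<open>sin t = 0\<close>, the real part
    alone decides.\<close>
  have "cis t = 1 \<longleftrightarrow> cos t = 1" for t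
    using sin_cos_squared_add[of t] by (auto simp: complex_eq_iff simp del: sin_cos_squared_add)
  then have "zeta k ^ m = 1 \<longleftrightarrow> (\<exists>i::int. real m / 2 ^ k = of_int i)"
    unfolding zeta_power_eq by (simp add: cos_one_2pi_int field_simps)
  also have "\<dots> \<longleftrightarrow> (\<exists>i::int. int m = 2 ^ k * i)"
  proof (intro ex_cong1)
    fix i :: int
    have "real m / 2 ^ k = of_int i \<longleftrightarrow> real_of_int (int m) = real_of_int (2 ^ k * i)"
      by (simp add: field_simps)
    then show "real m / 2 ^ k = of_int i \<longleftrightarrow> int m = 2 ^ k * i"
      by (simp only: of_int_eq_iff)
  qed
  also have "\<dots> \<longleftrightarrow> int (2 ^ k) dvd int m" by (simp add: dvd_def)
  finally show ?thesis by (simp only: int_dvd_int_iff)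
qed

lemma zeta_power_mod: "zeta k ^ (m mod 2 ^ k) = zeta k ^ m"
proof -
  have "zeta k ^ m = zeta k ^ (2 ^ k * (m div 2 ^ k)) * zeta k ^ (m mod 2 ^ k)"
    by (simp flip: power_add)
  moreover have "zeta k ^ (2 ^ k * (m div 2 ^ k)) = 1"
    by (simp add: zeta_power_eq_1_iff)
  ultimately show ?thesis by simp
qed

text \<open>\<open>unat w\<close> lies below the order of the root of unity. This faithfulness gives
  nondegeneracy with the multiplier 1.\<close>

lemma word_char_eq_1_iff: "word_char (w::'a::len word) = 1 \<longleftrightarrow> w = 0"
proof -
  have "2 ^ LENGTH('a) dvd unat w \<longleftrightarrow> unat w = 0"
    using unsigned_less[of w, where ?'a = nat] nat_dvd_not_less[of "unat w" "2 ^ LENGTH('a)"] by auto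
  then show ?thesis by (simp add: word_char_def zeta_power_eq_1_iff unat_eq_zero)
qed

interpretation word_char: nondegenerate_character "word_char :: 'k::len word \<Rightarrow> complex"
proof
  fix x y :: "'k word"
  show "word_char (x + y) = word_char x * word_char y"
    by (simp add: word_char_def unat_word_ariths zeta_power_mod power_add)
  show "cmod (word_char x) = 1"
    by (simp add: word_char_def zeta_power_eq)
  show "\<exists>u. word_char (u * x) \<noteq> 1" if "x \<noteq> 0"
    using that by (intro exI[of _ 1]) (simp add: word_char_eq_1_iff)
qed

lemma two_mult_half_word: "(2::'k::len word) * 2 ^ (LENGTH('k) - 1) = 0"
proof -
  have "(2::'k word) * 2 ^ (LENGTH('k) - 1) = 2 ^ LENGTH('k)"
    by (subst power_Suc[symmetric]) simp
  then show ?thesis by simp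
qed

text \<open>The half word is annihilated by 2, so only the parity of \<open>c\<close> survives, just
  as in \<open>sigma\<close>.\<close>

lemma half_word_mult:
  "(c::'k::len word) * 2 ^ (LENGTH('k) - 1) = (if odd c then 2 ^ (LENGTH('k) - 1) else 0)"
proof (cases "odd c")
  case True
  then obtain b where "c = 2 * b + 1" by (rule oddE)
  then have "c * 2 ^ (LENGTH('k) - 1) = b * (2 * 2 ^ (LENGTH('k) - 1)) + 2 ^ (LENGTH('k) - 1)"
    by (simp add: algebra_simps)
  then show ?thesis using True by (simp only: two_mult_half_word) simp
next
  case False
  then obtain b where "c = 2 * b" by (auto elim: evenE)
  then have "c * 2 ^ (LENGTH('k) - 1) = b * (2 * 2 ^ (LENGTH('k) - 1))"
    by (simp add: algebra_simps)
  then show ?thesis using False by (simp only: two_mult_half_word) simp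
qed

text \<open>The half word has additive order two, so its image under a faithful character is a
  square root of 1 other than 1.\<close>

lemma word_char_half: "word_char (2 ^ (LENGTH('k) - 1) :: 'k::len word) = - 1"
proof -
  let ?h = "2 ^ (LENGTH('k) - 1) :: 'k word"
  have "word_char ?h * word_char ?h = word_char (2 * ?h)"
    by (simp only: mult_2 word_char.add)
  then have "word_char ?h * word_char ?h = 1"
    by (simp only: two_mult_half_word word_char.zero)
  moreover have "word_char ?h \<noteq> 1"
    by (simp add: word_char_eq_1_iff)
  ultimately show ?thesis by (metis square_eq_1_iff)
qed

section \<open>Trace and quadratic form in characteristic two\<close>

text \<open>Polarisation of the second elementary symmetric polynomial: the product of the two sums
  contains the mixed pairs and also the diagonal, which the extra sum on the left balances.\<close>

lemma sum_pairs_add: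
  fixes a b :: "nat \<Rightarrow> 'r::comm_ring_1"
  shows "(\<Sum>j<n. \<Sum>i<j. (a i + b i) * (a j + b j)) + (\<Sum>i<n. a i * b i)
    = (\<Sum>j<n. \<Sum>i<j. a i * a j) + (\<Sum>j<n. \<Sum>i<j. b i * b j) + (\<Sum>i<n. a i) * (\<Sum>i<n. b i)"
proof (induction n)
  case (Suc n)
  have "(\<Sum>i<n. (a i + b i) * (a n + b n))
    = (\<Sum>i<n. a i * a n) + (\<Sum>i<n. b i * b n) + (\<Sum>i<n. a i) * b n + a n * (\<Sum>i<n. b i)"
    by (simp add: sum.distrib sum_distrib_left sum_distrib_right algebra_simps)
  then show ?case using Suc.IH by (simp add: algebra_simps)
qed simp

definition trace_char :: "nat \<Rightarrow> 'a::finite_field \<Rightarrow> complex" where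
  "trace_char n x = (- 1) ^ bit_val (abs_trace n x)"

text \<open>The absolute trace placed in the subgroup of order two of the words. It is unrelated to
  the half-trace used for solving quadratic equations over finite fields.\<close>

definition half_trace :: "nat \<Rightarrow> 'a::finite_field \<Rightarrow> 'k::len word" where
  "half_trace n x = 2 ^ (LENGTH('k) - 1) * of_nat (bit_val (abs_trace n x))"

definition phase :: "nat \<Rightarrow> 'k::len word \<Rightarrow> 'a::finite_field \<Rightarrow> complex" where
  "phase n c x = (- 1) ^ bit_val (sigma n c x)
     * \<i> ^ bit_val (abs_trace n (of_nat (unat c mod 2) * x))"

definition twisted_derivative ::
    "nat \<Rightarrow> ('a::finite_field \<Rightarrow> 'k::len word) \<Rightarrow> 'a \<Rightarrow> 'a \<Rightarrow> 'k word" where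
  "twisted_derivative n f z y = f (y + z) - f y + half_trace n (z * y)"

context
  fixes n :: nat
  assumes card: "CARD('a::finite_field) = 2 ^ n"
begin

lemma add_self_char_two: "(x::'a) + x = 0"
proof -
  have "(2::'a) = of_nat CHAR('a)" by (simp add: char_two[OF card])
  then have "(2::'a) = 0" by simp
  then show ?thesis by (metis mult_2 mult_zero_left)
qed

lemma add_power_two_power: "((x::'a) + y) ^ 2 ^ i = x ^ 2 ^ i + y ^ 2 ^ i"
  by (rule freshmans_dream') (simp_all add: char_two[OF card])

lemma abs_trace_add: "abs_trace n ((x::'a) + y) = abs_trace n x + abs_trace n y"
  by (simp add: abs_trace_def add_power_two_power sum.distrib)

text \<open>\<open>abs_trace\<close> and \<open>sigma_one\<close> are the first two elementary
  symmetric polynomials in the conjugates of the argument, and conjugation is additive, so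
  \<open>sum_pairs_add\<close> applies. In characteristic two the diagonal sum may change
  sides.\<close>

lemma sigma_one_add:
  "sigma_one n ((x::'a) + y)
    = sigma_one n x + sigma_one n y + abs_trace n x * abs_trace n y + abs_trace n (x * y)"
proof -
  have "sigma_one n (x + y) + abs_trace n (x * y)
      = sigma_one n x + sigma_one n y + abs_trace n x * abs_trace n y"
    unfolding sigma_one_def abs_trace_def add_power_two_power power_mult_distrib
    by (rule sum_pairs_add)
  then have "sigma_one n (x + y) + (abs_trace n (x * y) + abs_trace n (x * y))
      = sigma_one n x + sigma_one n y + abs_trace n x * abs_trace n y + abs_trace n (x * y)"
    by (simp only: add.assoc[symmetric])
  then show ?thesis by (simp only: add_self_char_two add_0_right)
qed

text \<open>The trace is a nonzero polynomial of degree at most \<open>2 ^ (n - 1)\<close>, too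
  small for \<open>2 ^ n\<close> roots.\<close>

lemma abs_trace_nonzero: "\<exists>x::'a. abs_trace n x \<noteq> 0"
proof (rule ccontr)
  assume "\<not> ?thesis"
  then have z: "abs_trace n x = 0" for x :: 'a by simp
  define p :: "'a poly" where "p = (\<Sum>i<n. monom 1 (2 ^ i))"
  have n: "n > 0"
  proof (rule ccontr)
    assume "\<not> n > 0"
    then have "CARD('a) = 1" using card by simp
    then show False by (metis card_1_singletonE UNIV_I singletonD zero_neq_one)
  qed
  \<comment> \<open>Among the exponents \<open>2 ^ i\<close> only \<open>i = 0\<close> gives 1;
    \<open>n > 0\<close> ensures that this term is present.\<close>
  have "coeff p 1 = (\<Sum>i<n. if i = 0 then 1 else 0)"
    unfolding p_def coeff_sum coeff_monom
    by (intro sum.cong) auto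
  also have "\<dots> = 1" using n by simp
  finally have "p \<noteq> 0" by auto
  have "degree p \<le> 2 ^ (n - 1)"
    unfolding p_def
    by (intro degree_sum_le) (auto simp: degree_monom_eq intro!: power_increasing)
  moreover have "card {x. poly p x = 0} \<le> degree p"
    using \<open>p \<noteq> 0\<close> by (rule card_poly_roots_bound)
  moreover have "{x. poly p x = 0} = UNIV"
    using z by (auto simp: p_def poly_sum poly_monom abs_trace_def)
  ultimately have "2 ^ n \<le> (2::nat) ^ (n - 1)" by (metis card le_trans)
  then show False using n by (simp add: power_increasing_iff)
qed

lemma minus_one_power_bit_val_add:
  assumes "(s::'a) \<in> {0, 1}" and "t \<in> {0, 1}"
  shows "(- 1 :: complex) ^ bit_val (s + t) = (- 1) ^ bit_val s * (- 1) ^ bit_val t"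
  using assms add_self_char_two[of 1] by (auto simp: bit_val_def)

text \<open>When both bits are 1 the sum wraps to 0 while the product of the powers is -1; the last
  factor corrects this carry.\<close>

lemma i_power_bit_val_add:
  assumes "(s::'a) \<in> {0, 1}" and "t \<in> {0, 1}"
  shows "\<i> ^ bit_val (s + t) = \<i> ^ bit_val s * \<i> ^ bit_val t * (- 1) ^ bit_val (s * t)"
  using assms add_self_char_two[of 1] by (auto simp: bit_val_def)

lemma trace_char_add: "trace_char n ((x::'a) + y) = trace_char n x * trace_char n y"
  unfolding trace_char_def abs_trace_add
  by (intro minus_one_power_bit_val_add abs_trace_in_prime_field[OF card])

lemma nondegenerate_trace_char: "nondegenerate_character (trace_char n :: 'a \<Rightarrow> complex)"
proof
  fix x y :: 'a
  show "trace_char n (x + y) = trace_char n x * trace_char n y"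
    by (rule trace_char_add)
  show "cmod (trace_char n x) = 1"
    by (simp add: trace_char_def norm_power)
  show "\<exists>u. trace_char n (u * x) \<noteq> 1" if x: "x \<noteq> 0"
  proof -
    obtain a :: 'a where "abs_trace n a \<noteq> 0" using abs_trace_nonzero by blast
    \<comment> \<open>In a field any nonzero \<open>x\<close> can be scaled to an element of nonzero
      trace.\<close>
    then have "trace_char n (a / x * x) \<noteq> 1"
      using x by (simp add: trace_char_def bit_val_def)
    then show ?thesis by blast
  qed
qed

lemma half_trace_add:
  "half_trace n ((x::'a) + y) = (half_trace n x + half_trace n y :: 'k::len word)"
proof -
  have h: "(2::'k word) ^ (LENGTH('k) - 1) + 2 ^ (LENGTH('k) - 1) = 0"
    using two_mult_half_word[where ?'k = 'k] by (simp only: mult_2)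
  have "abs_trace n x \<in> {0, 1}" "abs_trace n y \<in> {0, 1}"
    by (rule abs_trace_in_prime_field[OF card])+
  then show ?thesis
    unfolding half_trace_def abs_trace_add
    using add_self_char_two[of 1] h by (auto simp: bit_val_def)
qed

lemma half_trace_0 [simp]: "half_trace n (0::'a) = 0"
  by (simp add: half_trace_def abs_trace_def bit_val_def power_0_left)

lemma half_trace_add_self [simp]: "half_trace n (x::'a) + half_trace n x = (0 :: 'k::len word)"
  by (simp add: half_trace_add[symmetric] add_self_char_two)

lemma word_char_mult_half_trace:
  "word_char ((c::'k::len word) * half_trace n (x::'a)) = (if odd c then trace_char n x else 1)"
proof -
  have "c * half_trace n x
      = (if odd c then 2 ^ (LENGTH('k) - 1) else 0) * of_nat (bit_val (abs_trace n x))"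
    by (simp only: half_trace_def mult.assoc[symmetric] half_word_mult)
  then show ?thesis
    by (simp add: trace_char_def bit_val_def word_char_half[unfolded One_nat_def])
qed

lemma unat_mod_two: "unat (c::'k::len word) mod 2 = (if odd c then 1 else 0)"
proof -
  have "even (unat c) \<longleftrightarrow> even c"
    by transfer (simp add: even_nat_iff even_take_bit_eq)
  then show ?thesis by (simp add: mod_2_eq_odd)
qed

lemma phase_even: "even c \<Longrightarrow> phase n (c::'k::len word) (x::'a) = 1"
  by (simp add: phase_def sigma_def bit_val_def abs_trace_def power_0_left
      unat_mod_two)

lemma phase_odd:
  "odd c \<Longrightarrow> phase n (c::'k::len word) (x::'a)
     = (- 1) ^ bit_val (sigma_one n x) * \<i> ^ bit_val (abs_trace n x)"
  by (simp add: phase_def sigma_def unat_mod_two)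

text \<open>For odd \<open>c\<close>, the mixed term of \<open>sigma_one_add\<close> and the carry
  of \<open>i_power_bit_val_add\<close> are the same sign and cancel. Only the sign of the trace of
  \<open>x * y\<close> remains, which is the value of \<open>word_char\<close> at
  \<open>c * half_trace n (x * y)\<close>.\<close>

lemma phase_add:
  "phase n (c::'k::len word) ((x::'a) + y)
     = phase n c x * phase n c y * word_char (c * half_trace n (x * y))"
proof (cases "odd c")
  case True
  note in01 = sigma_one_in_prime_field[OF card] abs_trace_in_prime_field[OF card]
  have in01': "s + t \<in> {0, 1}" "s * t \<in> {0, 1}" if "s \<in> {0, 1}" "t \<in> {0, 1}" for s t :: 'a
    using that add_self_char_two[of 1] by auto
  have "(- 1 :: complex) ^ bit_val (sigma_one n (x + y)) =
      (- 1) ^ bit_val (sigma_one n x) * (- 1) ^ bit_val (sigma_one n y)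
      * (- 1) ^ bit_val (abs_trace n x * abs_trace n y) * trace_char n (x * y)"
    unfolding sigma_one_add trace_char_def
    by (simp only: minus_one_power_bit_val_add in01 in01')
  moreover have "\<i> ^ bit_val (abs_trace n (x + y)) =
      \<i> ^ bit_val (abs_trace n x) * \<i> ^ bit_val (abs_trace n y)
      * (- 1) ^ bit_val (abs_trace n x * abs_trace n y)"
    unfolding abs_trace_add by (intro i_power_bit_val_add in01)
  moreover have "((- 1 :: complex) ^ m) * (- 1) ^ m = 1" for m
    by (simp flip: power_mult_distrib)
  ultimately show ?thesis
    using True by (simp add: phase_odd word_char_mult_half_trace mult_ac)
next
  case False
  then show ?thesis by (simp add: phase_even word_char_mult_half_trace)
qed

lemma norm_phase: "cmod (phase n c (x::'a)) = 1"
  by (simp add: phase_def norm_mult norm_power)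

section \<open>Squared modulus of the transform and the balance criterion\<close>

lemma nega_transform_eq:
  "nega_transform n f c u = (\<Sum>x\<in>UNIV. trace_char n (u * x) * phase n c x * word_char (c * f x))"
  for f :: "'a \<Rightarrow> 'k::len word"
  unfolding nega_transform_def trace_char_def phase_def word_char_def
  by (intro sum.cong refl) (simp add: power_add mult_ac)

lemma twisted_derivative_0: "twisted_derivative n f (0::'a) y = 0"
  by (simp add: twisted_derivative_def)

lemma nega_transform_norm_square:
  fixes f :: "'a \<Rightarrow> 'k::len word"
  shows "complex_of_real ((cmod (nega_transform n f c u))\<^sup>2)
    = (\<Sum>z\<in>UNIV. trace_char n (u * z)
        * (phase n c z * (\<Sum>y\<in>UNIV. word_char (c * twisted_derivative n f z y))))"
proof -
  interpret trace_char: nondegenerate_character "trace_char n :: 'a \<Rightarrow> complex"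
    by (rule nondegenerate_trace_char)
  define F where "F x = trace_char n (u * x) * phase n c x * word_char (c * f x)" for x
  have phase: "phase n c x * cnj (phase n c x) = 1" for x :: 'a
    by (simp add: norm_phase flip: complex_norm_square)
  have F: "F (y + z) * cnj (F y)
      = trace_char n (u * z) * (phase n c z * word_char (c * twisted_derivative n f z y))" for y z
  proof -
    \<comment> \<open>The factors are grouped so that the bracket becomes the character at the
      twisted derivative and the last two pairs become 1; \<open>u\<close> then occurs only together
      with \<open>z\<close>.\<close>
    have "F (y + z) * cnj (F y) = trace_char n (u * z) * phase n c z
        * (word_char (c * f (y + z)) * cnj (word_char (c * f y)) * word_char (c * half_trace n (z * y)))
        * (trace_char n (u * y) * cnj (trace_char n (u * y))) * (phase n c y * cnj (phase n c y))"
      by (simp add: F_def distrib_left trace_char.add phase_add mult_ac del: trace_char.mult_cnj)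
    also have "\<dots> = trace_char n (u * z) * phase n c z * word_char (c * twisted_derivative n f z y)"
      by (simp only: phase trace_char.mult_cnj twisted_derivative_def distrib_left
            right_diff_distrib word_char.add word_char.diff mult_1_right)
    finally show ?thesis by (simp only: mult.assoc)
  qed
  have "complex_of_real ((cmod (nega_transform n f c u))\<^sup>2) = (\<Sum>x\<in>UNIV. F x) * cnj (\<Sum>x\<in>UNIV. F x)"
    unfolding nega_transform_eq F_def by (rule complex_norm_square)
  also have "\<dots> = (\<Sum>y\<in>UNIV. \<Sum>x\<in>UNIV. F x * cnj (F y))"
    by (simp add: sum_product cnj_sum) (rule sum.swap)
  also have "\<dots> = (\<Sum>y\<in>UNIV. \<Sum>z\<in>UNIV. F (y + z) * cnj (F y))"
  proof (rule sum.cong[OF refl])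
    fix y
    show "(\<Sum>x\<in>UNIV. F x * cnj (F y)) = (\<Sum>z\<in>UNIV. F (y + z) * cnj (F y))"
      by (rule sum.reindex_bij_witness[of _ "\<lambda>z. y + z" "\<lambda>x. x - y"]) auto
  qed
  also have "\<dots> = (\<Sum>z\<in>UNIV. \<Sum>y\<in>UNIV. F (y + z) * cnj (F y))"
    by (rule sum.swap)
  finally show ?thesis by (simp only: F sum_distrib_left)
qed

lemma nega_bent_iff_balanced:
  fixes f :: "'a \<Rightarrow> 'k::len word"
  shows "nega_bent n f \<longleftrightarrow> (\<forall>z. z \<noteq> 0 \<longrightarrow> balanced (twisted_derivative n f z))"
proof -
  interpret trace_char: nondegenerate_character "trace_char n :: 'a \<Rightarrow> complex"
    by (rule nondegenerate_trace_char)
  define A where "A c z = phase n c z * (\<Sum>y\<in>UNIV. word_char (c * twisted_derivative n f z y))" for c z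
  have phase_0: "phase n c (0::'a) = 1" for c :: "'k word"
    by (simp add: phase_def sigma_def sigma_one_def abs_trace_def bit_val_def power_0_left)
  have A_0: "A c 0 = 2 ^ n" for c
    by (simp add: A_def phase_0 twisted_derivative_0 card)
  have A_eq_0: "A c z = 0 \<longleftrightarrow> (\<Sum>y\<in>UNIV. word_char (c * twisted_derivative n f z y)) = 0" for c z
    using norm_phase[of c z] by (auto simp: A_def)
  \<comment> \<open>Both sides are nonnegative and can be squared; the equation is moved to the
    complex numbers to match \<open>nega_transform_norm_square\<close>.\<close>
  have sq: "cmod K = 2 powr (real n / 2) \<longleftrightarrow> complex_of_real ((cmod K)\<^sup>2) = 2 ^ n" for K
  proof -
    have "(2 powr (real n / 2))\<^sup>2 = (2::real) ^ n"
      by (simp add: power2_eq_square powr_realpow flip: powr_add)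
    then have "cmod K = 2 powr (real n / 2) \<longleftrightarrow> (cmod K)\<^sup>2 = 2 ^ n"
      by (metis norm_ge_zero power2_eq_imp_eq powr_ge_zero)
    also have "\<dots> \<longleftrightarrow> complex_of_real ((cmod K)\<^sup>2) = complex_of_real (2 ^ n)"
      by (simp only: of_real_eq_iff)
    finally show ?thesis by simp
  qed
  have "nega_bent n f \<longleftrightarrow> (\<forall>c. c \<noteq> 0 \<longrightarrow> (\<forall>u. trace_char.fourier (A c) u = A c 0))"
    unfolding nega_bent_def sq nega_transform_norm_square trace_char.fourier_def A_0
    unfolding A_def by blast
  \<comment> \<open>Field inversion is applied for each fixed \<open>c\<close>; exchanging the
    quantifiers prepares inversion over the words for each fixed \<open>z\<close>.\<close>
  also have "\<dots> \<longleftrightarrow> (\<forall>z. z \<noteq> 0 \<longrightarrow> (\<forall>c. c \<noteq> 0 \<longrightarrow> A c z = 0))"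
    unfolding trace_char.fourier_eq_const_iff by blast
  finally show ?thesis
    by (simp only: A_eq_0 word_char.balanced_iff_character_sums)
qed

section \<open>Relative difference sets in the twisted product\<close>

lemma star_group_mult:
  "(x1::'a, y1::'k::len word) \<otimes>\<^bsub>star_group n\<^esub> (x2, y2)
     = (x1 + x2, y1 + y2 + half_trace n (x1 * x2))"
  by (simp add: star_group_def half_trace_def)

lemma star_group_carrier [simp]: "carrier (star_group n) = UNIV"
  by (simp add: star_group_def)

lemma star_group_one: "\<one>\<^bsub>star_group n\<^esub> = (0, 0)"
  by (simp add: star_group_def)

text \<open>Associativity is the cocycle condition for \<open>half_trace n (x1 * x2)\<close>, which
  holds because this expression is additive in each argument.\<close>

lemma group_star_group: "group (star_group n :: ('a \<times> 'k::len word) monoid)"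
proof (rule groupI)
  fix p q r :: "'a \<times> 'k word"
  show "p \<otimes>\<^bsub>star_group n\<^esub> q \<otimes>\<^bsub>star_group n\<^esub> r = p \<otimes>\<^bsub>star_group n\<^esub> (q \<otimes>\<^bsub>star_group n\<^esub> r)"
    by (cases p; cases q; cases r)
      (simp add: star_group_mult half_trace_add distrib_left distrib_right add_ac)
  show "\<one>\<^bsub>star_group n\<^esub> \<otimes>\<^bsub>star_group n\<^esub> p = p"
    by (cases p) (simp add: star_group_mult star_group_one)
  show "\<exists>q\<in>carrier (star_group n). q \<otimes>\<^bsub>star_group n\<^esub> p = \<one>\<^bsub>star_group n\<^esub>"
  proof (cases p)
    case (Pair x y)
    \<comment> \<open>In characteristic two \<open>x\<close> is its own negative, and the second
      component cancels both \<open>y\<close> and the cocycle at \<open>(x, x)\<close>.\<close>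
    then have "(x, - y - half_trace n (x * x)) \<otimes>\<^bsub>star_group n\<^esub> p = \<one>\<^bsub>star_group n\<^esub>"
      by (simp add: star_group_mult star_group_one add_self_char_two)
    then show ?thesis by auto
  qed
qed simp_all

lemma subgroup_star_group: "subgroup ({0} \<times> UNIV) (star_group n :: ('a \<times> 'k::len word) monoid)"
proof -
  interpret group "star_group n :: ('a \<times> 'k word) monoid" by (rule group_star_group)
  have inv: "inv\<^bsub>star_group n\<^esub> (0::'a, y::'k word) = (0, - y)" for y
    by (rule inv_equality) (simp_all add: star_group_mult star_group_one)
  show ?thesis
    by (rule subgroupI) (auto simp: inv star_group_mult)
qed

text \<open>Multiplying by \<open>(y, f y)\<close> on the right avoids an explicit inverse.\<close>

lemma star_group_diff_eq_iff:
  fixes f :: "'a \<Rightarrow> 'k::len word"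
  shows "(x, f x) \<otimes>\<^bsub>star_group n\<^esub> inv\<^bsub>star_group n\<^esub> (y, f y) = (z, w)
    \<longleftrightarrow> x = y + z \<and> twisted_derivative n f z y = w"
proof -
  interpret group "star_group n :: ('a \<times> 'k word) monoid" by (rule group_star_group)
  have "(x, f x) \<otimes>\<^bsub>star_group n\<^esub> inv\<^bsub>star_group n\<^esub> (y, f y) = (z, w)
      \<longleftrightarrow> (x, f x) = (z, w) \<otimes>\<^bsub>star_group n\<^esub> (y, f y)"
    using inv_solve_right[of "(z, w)" "(x, f x)" "(y, f y)"] by auto
  also have "\<dots> \<longleftrightarrow> x = y + z \<and> f (y + z) = w + f y + half_trace n (z * y)"
    by (auto simp: star_group_mult add.commute)
  also have "f (y + z) = w + f y + half_trace n (z * y) \<longleftrightarrow> twisted_derivative n f z y = w"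
  proof -
    \<comment> \<open>Solving for \<open>w\<close> produces a minus sign; a half trace equals its
      own negative.\<close>
    have "twisted_derivative n f z y = f (y + z) - f y - half_trace n (z * y)"
      using half_trace_add_self[of "z * y", where ?'k = 'k]
      by (simp only: twisted_derivative_def eq_neg_iff_add_eq_0 diff_conv_add_uminus)
        (metis add.inverse_unique)
    then show ?thesis by (auto simp: algebra_simps)
  qed
  finally show ?thesis .
qed

text \<open>The base point \<open>y\<close> of the subtracted graph point determines the whole
  pair.\<close>

lemma card_graph_differences:
  fixes f :: "'a \<Rightarrow> 'k::len word"
  shows "card {(r1, r2). r1 \<in> {(x, f x) |x. True} \<and> r2 \<in> {(x, f x) |x. True}
      \<and> r1 \<otimes>\<^bsub>star_group n\<^esub> inv\<^bsub>star_group n\<^esub> r2 = (z, w)}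
    = card {y. twisted_derivative n f z y = w}" (is "card ?S = card ?T")
proof -
  have "?S = (\<lambda>y. ((y + z, f (y + z)), (y, f y))) ` ?T"
    by (auto simp: star_group_diff_eq_iff)
  moreover have "inj_on (\<lambda>y. ((y + z, f (y + z)), (y, f y))) ?T"
    by (auto intro: inj_onI)
  ultimately show ?thesis by (simp only: card_image)
qed

text \<open>Equal fibres partition the \<open>2 ^ n\<close> points. If the word length exceeds
  \<open>n\<close>, both sides are false, as the prescribed size is not an integer.\<close>

lemma balanced_iff_card_fibre:
  fixes h :: "'a \<Rightarrow> 'k::len word"
  shows "balanced h \<longleftrightarrow> (\<forall>w. real (card {y. h y = w}) = 2 powi (int n - int LENGTH('k)))"
proof
  assume bal: "balanced h"
  show "\<forall>w. real (card {y. h y = w}) = 2 powi (int n - int LENGTH('k))"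
  proof
    fix w
    have "2 ^ n = (\<Sum>y\<in>(UNIV::'a set). 1::nat)" by (simp add: card)
    also have "\<dots> = (\<Sum>v\<in>UNIV. \<Sum>y | y \<in> UNIV \<and> h y = v. 1)"
      by (rule sum.group[symmetric]) auto
    also have "\<dots> = (\<Sum>v\<in>(UNIV::'k word set). card {y. h y = w})"
      using bal by (intro sum.cong refl) (simp add: balanced_def)
    also have "\<dots> = 2 ^ LENGTH('k) * card {y. h y = w}" by (simp add: card_word)
    finally have "real (2 ^ n) = real (2 ^ LENGTH('k) * card {y. h y = w})" by (rule arg_cong)
    then show "real (card {y. h y = w}) = 2 powi (int n - int LENGTH('k))"
      by (simp add: power_int_diff field_simps)
  qed
qed (simp add: balanced_def flip: of_nat_eq_iff[where ?'a = real])

lemma balanced_iff_relative_difference_set: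
  fixes f :: "'a \<Rightarrow> 'k::len word"
  shows "(\<forall>z. z \<noteq> 0 \<longrightarrow> balanced (twisted_derivative n f z))
    \<longleftrightarrow> relative_difference_set (star_group n) ({0} \<times> UNIV) (2 ^ n) (2 ^ LENGTH('k)) (2 ^ n)
          (2 powi (int n - int LENGTH('k))) {(x, f x) |x. True}"
    (is "_ \<longleftrightarrow> relative_difference_set ?G ?N _ _ _ ?l ?R")
proof -
  have order: "Coset.order ?G = 2 ^ n * 2 ^ LENGTH('k)"
    by (simp add: Coset.order_def card card_word card_cartesian_product flip: UNIV_Times_UNIV)
  have cardN: "card ?N = 2 ^ LENGTH('k)"
    by (simp add: card_cartesian_product card_word)
  have "?R = (\<lambda>x. (x, f x)) ` UNIV" by auto
  then have cardR: "card ?R = 2 ^ n"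
    by (simp add: card_image inj_on_def card)
  \<comment> \<open>A difference in the forbidden subgroup has \<open>z = 0\<close>, hence equal
    base points and trivial difference; this holds for every \<open>f\<close>.\<close>
  have no_diff: "\<forall>g \<in> ?N - {\<one>\<^bsub>?G\<^esub>}. \<not> (\<exists>r1\<in>?R. \<exists>r2\<in>?R. r1 \<otimes>\<^bsub>?G\<^esub> inv\<^bsub>?G\<^esub> r2 = g)"
    by (auto simp: star_group_one star_group_diff_eq_iff twisted_derivative_0)
  have "(\<forall>z. z \<noteq> 0 \<longrightarrow> balanced (twisted_derivative n f z))
      \<longleftrightarrow> (\<forall>z w. z \<noteq> 0 \<longrightarrow> real (card {y. twisted_derivative n f z y = w}) = ?l)"
    unfolding balanced_iff_card_fibre by blast
  also have "\<dots> \<longleftrightarrow> (\<forall>g \<in> carrier ?G - ?N.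
      real (card {(r1, r2). r1 \<in> ?R \<and> r2 \<in> ?R \<and> r1 \<otimes>\<^bsub>?G\<^esub> inv\<^bsub>?G\<^esub> r2 = g}) = ?l)"
    unfolding card_graph_differences[symmetric] by auto
  finally show ?thesis
    unfolding relative_difference_set_def
    using group_star_group subgroup_star_group order cardN cardR no_diff
    by (simp only: star_group_carrier subset_UNIV) blast
qed

end

theorem theorem3p14:
  fixes f :: "'a::finite_field \<Rightarrow> 'k::len word"
    and n k :: nat
  assumes "CARD('a) = 2 ^ n" and "LENGTH('k) = k"
  shows "(nega_bent n f \<longleftrightarrow>
            (\<forall>z. z \<noteq> 0 \<longrightarrow>
               balanced (\<lambda>y. f (y + z) - f y + 2 ^ (k - 1) * of_nat (bit_val (abs_trace n (z * y))))))
       \<and> ((\<forall>z. z \<noteq> 0 \<longrightarrow>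
               balanced (\<lambda>y. f (y + z) - f y + 2 ^ (k - 1) * of_nat (bit_val (abs_trace n (z * y)))))
          \<longleftrightarrow> relative_difference_set (star_group n) ({0} \<times> UNIV)
                (2 ^ n) (2 ^ k) (2 ^ n) (2 powi (int n - int k)) {(x, f x) |x. True})"
  using nega_bent_iff_balanced[OF assms(1), of f] balanced_iff_relative_difference_set[OF assms(1), of f]
  unfolding twisted_derivative_def half_trace_def assms(2)
  by blast

end
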